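(* Let $E$ be a Banach space and let $X$ be an $E$-valued random element whose law $\mu$ is a centered Gaussian measure that is non-degenerate, i.e. $\mu(A)>0$ for every non-empty open set $A\subset E$. Let $V:E\to\mathbb R$ be a Borel measurable mapping and let $\mathcal U_0\subset E$ be an open subset such that $V$ is of class $\mathcal C^1$ on $\mathcal U_0$. Assume that $d_fV\ne0$ for some $f\in\mathcal U_0$. Then there exists an open neighborhood $\mathcal O\subset\mathcal U_0$ of $f$ such that the law of the random variable $V1_{\mathcal O}:=V(X)1_{\mathcal O}(X)$ is absolutely continuous with respect to the Lebesgue measure.
   Context: $1_{\mathcal O}$ is the indicator function of $\mathcal O$. $V$ is of class $\mathcal C^1$ on $\mathcal U_0$ if there is a continuous mapping $dV:\mathcal U_0\to E^*$, $f\mapsto d_fV$, such that for all $f\in\mathcal U_0$, $V(f+g)=V(f)+\langle d_fV,g\rangle+o(\|g\|)$ as $g\to0$ in $E$. Gaussian measures on Banach spaces are understood in the usual sense; non-degeneracy of $\mu$ is equivalent to the Cameron–Martin space of $\mu$ being dense in $E$.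
   Formalization: The law of V1_O has an atom at 0 of mass P(X not in O), so it is not absolutely continuous in general (E=R, U_0=(-1,1), V(x)=x, f=0); proved instead: the measure B -> P(V(X) in B, X in O), i.e. the law of V(X) on the event that X lies in O, is absolutely continuous. *)

theory Defs
  imports "HOL-Probability.Probability"
begin

text \<open>Borel probability measures all of whose one-dimensional marginals under the topological
  dual are centered normal; the Dirac mass at 0 counts as the normal law of variance 0.
  Separability of the space is not assumed: a finite Borel measure that charges every
  non-empty open set can only live on a separable metric space.\<close>

definition centered_gaussian_measure :: "'a::banach measure \<Rightarrow> bool" where
  "centered_gaussian_measure \<mu> \<longleftrightarrow>
     prob_space \<mu> \<and> sets \<mu> = sets borel \<and>
     (\<forall>l :: 'a \<Rightarrow>\<^sub>L real. \<exists>\<sigma>\<ge>0.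
        distr \<mu> borel (blinfun_apply l) =
          (if \<sigma> = 0 then return borel 0 else density lborel (normal_density 0 \<sigma>)))"

definition nondegenerate_measure :: "'a::topological_space measure \<Rightarrow> bool" where
  "nondegenerate_measure \<mu> \<longleftrightarrow> (\<forall>A. open A \<longrightarrow> A \<noteq> {} \<longrightarrow> emeasure \<mu> A > 0)"

text \<open>The dual carries its norm topology.\<close>

definition C1_on_with ::
    "('a::real_normed_vector \<Rightarrow> real) \<Rightarrow> 'a set \<Rightarrow> ('a \<Rightarrow> 'a \<Rightarrow>\<^sub>L real) \<Rightarrow> bool" where
  "C1_on_with V U dV \<longleftrightarrow>
     continuous_on U dV \<and> (\<forall>f\<in>U. (V has_derivative blinfun_apply (dV f)) (at f))"

text \<open>The distribution of \<open>Y\<close> on the event \<open>A\<close>, i.e. the (not normalised) measure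
  \<open>B \<mapsto> P({Y \<in> B} \<inter> A)\<close>.\<close>

definition law_on :: "'w measure \<Rightarrow> 'w set \<Rightarrow> ('w \<Rightarrow> real) \<Rightarrow> real measure" where
  "law_on M A Y = distr (restrict_space M (A \<inter> space M)) borel Y"

text \<open>A variable \<open>Y\<close> cut off to 0 outside an event \<open>A\<close> has, besides its law on \<open>A\<close>, an atom of
  mass \<open>P(A\<^sup>c)\<close> at 0. So unless \<open>P(A) = 1\<close> its full law is never absolutely continuous, and
  absolute continuity of a cut-off variable has to be read as that of its law on \<open>A\<close>.\<close>

lemma emeasure_distr_cutoff:
  assumes A: "A \<inter> space M \<in> sets M" and Y: "Y \<in> borel_measurable M"
    and off: "\<And>\<omega>. \<omega> \<in> space M \<Longrightarrow> \<omega> \<notin> A \<Longrightarrow> Y \<omega> = 0" and B: "B \<in> sets borel"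
  shows "emeasure (distr M borel Y) B =
           emeasure (law_on M A Y) B + emeasure M (space M - A) * indicator B 0"
proof -
  let ?A = "A \<inter> space M" and ?P = "Y -` B \<inter> space M"
  have P: "?P \<in> sets M" using Y B by (rule measurable_sets)
  have "Y \<in> borel_measurable (restrict_space M ?A)"
    using Y by (rule measurable_restrict_space1)
  then have "emeasure (law_on M A Y) B =
      emeasure (restrict_space M ?A) (Y -` B \<inter> space (restrict_space M ?A))"
    using B by (simp add: law_on_def emeasure_distr)
  also have "Y -` B \<inter> space (restrict_space M ?A) = ?P \<inter> ?A"
    by (auto simp: space_restrict_space)
  also have "emeasure (restrict_space M ?A) (?P \<inter> ?A) = emeasure M (?P \<inter> ?A)"
    using A by (intro emeasure_restrict_space) auto
  finally have 1: "emeasure (law_on M A Y) B = emeasure M (?P \<inter> ?A)" .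
  have eq: "?P - ?A = (if 0 \<in> B then space M - A else {})"
  proof (cases "0 \<in> B")
    case True
    then show ?thesis using off by fastforce
  next
    case False
    have "\<omega> \<in> A" if "\<omega> \<in> space M" "Y \<omega> \<in> B" for \<omega>
      using off[of \<omega>] that False by metis
    then show ?thesis using False by auto
  qed
  have 2: "emeasure M (?P - ?A) = emeasure M (space M - A) * indicator B 0"
    unfolding eq by simp
  have "emeasure (distr M borel Y) B = emeasure M ?P"
    using Y B by (simp add: emeasure_distr)
  also have "\<dots> = emeasure M (?P \<inter> ?A) + emeasure M (?P - ?A)"
    using P A by (subst plus_emeasure) (auto intro!: arg_cong[where f="emeasure M"])
  finally show ?thesis using 1 2 by simp
qed

lemma absolutely_continuous_cutoff_imp_full:
  fixes Y :: "'w \<Rightarrow> real"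
  assumes A: "A \<inter> space M \<in> sets M" and Y: "Y \<in> borel_measurable M"
    and off: "\<And>\<omega>. \<omega> \<in> space M \<Longrightarrow> \<omega> \<notin> A \<Longrightarrow> Y \<omega> = 0"
    and ac: "absolutely_continuous lborel (distr M borel Y)"
  shows "emeasure M (space M - A) = 0"
proof -
  have "{0::real} \<in> null_sets lborel" by (simp add: null_sets_def)
  with ac have "{0} \<in> null_sets (distr M borel Y)"
    unfolding absolutely_continuous_def by (rule subsetD)
  then have 0: "emeasure (distr M borel Y) {0} = 0" by (rule null_setsD1)
  have "emeasure (distr M borel Y) {0} =
      emeasure (law_on M A Y) {0} + emeasure M (space M - A) * indicator {0::real} (0::real)"
    by (rule emeasure_distr_cutoff[OF A Y off]) simp_all
  then show ?thesis unfolding 0 by simp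
qed

end

theory Submission
  imports Defs
begin

text \<open>Let \<open>X\<close>, \<open>X'\<close> be independent with law \<open>\<mu>\<close>. Rotation invariance says that the pair
  \<open>X\<^sub>\<theta> = cos \<theta> X + sin \<theta> X'\<close>, \<open>X'\<^sub>\<theta> = - sin \<theta> X + cos \<theta> X'\<close> has law \<open>\<mu> \<otimes> \<mu>\<close> for every \<open>\<theta>\<close>.
  As \<open>d/d\<theta> V(X\<^sub>\<theta>) = \<langle>dV(X\<^sub>\<theta>), X'\<^sub>\<theta>\<rangle>\<close>, for a Lebesgue null set \<open>N\<close> and fixed \<open>X\<close>, \<open>X'\<close> the set of
  those \<open>\<theta>\<close> with \<open>V(X\<^sub>\<theta>) \<in> N\<close> and \<open>\<langle>dV(X\<^sub>\<theta>), X'\<^sub>\<theta>\<rangle> \<noteq> 0\<close> is null. Integrating over \<open>\<theta>\<close> and using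
  Fubini, the event \<open>V(X) \<in> N\<close>, \<open>\<langle>dV(X), X'\<rangle> \<noteq> 0\<close> is null. Where \<open>dV(X) \<noteq> 0\<close> the second
  condition holds almost surely, since non-degeneracy makes \<open>\<langle>dV(x), X'\<rangle>\<close> normal with positive
  variance. So \<open>\<O>\<close> can be the set of all points of \<open>U\<^sub>0\<close> at which \<open>dV\<close> does not vanish. No
  Cameron-Martin theory is needed.

  Measurability of sums and the rotation invariance rest on the Borel sets being generated by
  the dual, which follows from Hahn-Banach once the space is known to be separable.\<close>

subsection \<open>Norming functionals\<close>

definition sublinear :: "('a::real_vector \<Rightarrow> real) \<Rightarrow> bool" where
  "sublinear p \<longleftrightarrow> (\<forall>x y. p (x + y) \<le> p x + p y) \<and> (\<forall>t\<ge>0. \<forall>x. p (t *\<^sub>R x) = t * p x)"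

lemma sublinear_add: "sublinear p \<Longrightarrow> p (x + y) \<le> p x + p y"
  and sublinear_scale: "sublinear p \<Longrightarrow> t \<ge> 0 \<Longrightarrow> p (t *\<^sub>R x) = t * p x"
  by (auto simp: sublinear_def)

lemma sublinear_zero: "sublinear p \<Longrightarrow> p 0 = 0"
  using sublinear_scale[of p 0 0] by simp

lemma sublinear_minus: "sublinear p \<Longrightarrow> - p (- x) \<le> p x"
  using sublinear_add[of p x "- x"] by (simp add: sublinear_zero)

text \<open>Using \<open>scale\<close> once for \<open>t\<close> and once for
  \<open>inverse t\<close> upgrades the one-sided bound to equality, so later proofs of sublinearity
  only have to check an inequality for positive \<open>t\<close>.\<close>

lemma sublinearI:
  assumes add: "\<And>x y. p (x + y) \<le> p x + p y" and zero: "p 0 = 0"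
    and scale: "\<And>t x. t > 0 \<Longrightarrow> p (t *\<^sub>R x) \<le> t * p x"
  shows "sublinear p"
proof -
  have "p (t *\<^sub>R x) = t * p x" if "t > 0" for t x
  proof (rule antisym)
    have "p x \<le> inverse t * p (t *\<^sub>R x)"
      using scale[of "inverse t" "t *\<^sub>R x"] that by simp
    then show "t * p x \<le> p (t *\<^sub>R x)"
      using that by (simp add: field_simps)
  qed (rule scale[OF that])
  then show ?thesis
    unfolding sublinear_def using add zero by (metis less_eq_real_def mult_zero_left scaleR_zero_left)
qed

text \<open>A sublinear \<open>p\<close> that is minimal in the pointwise order equals all its tilts, and
  \<open>tilt p y x \<le> p (x + y) - p y\<close> then makes \<open>p\<close> additive. Tilting the norm along \<open>a\<close> also
  forces the value \<open>- norm a\<close> at \<open>- a\<close>.\<close>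

definition tilt :: "('a::real_vector \<Rightarrow> real) \<Rightarrow> 'a \<Rightarrow> 'a \<Rightarrow> real" where
  "tilt p y x = (INF t\<in>{0..}. p (x + t *\<^sub>R y) - t * p y)"

lemma tilt_le:
  assumes p: "sublinear p" and "t \<ge> 0"
  shows "tilt p y x \<le> p (x + t *\<^sub>R y) - t * p y"
proof -
  \<comment> \<open>A lower bound that does not depend on \<open>t\<close>; it makes the infimum
    over the half-line a genuine real infimum, below each of its members.\<close>
  have "- p (- x) \<le> p (x + t *\<^sub>R y) - t * p y" if "t \<ge> 0" for t
    using sublinear_add[OF p, of "x + t *\<^sub>R y" "- x"] sublinear_scale[OF p that, of y] by simp
  then have "bdd_below ((\<lambda>t. p (x + t *\<^sub>R y) - t * p y) ` {0..})"
    by (intro bdd_belowI2[of _ "- p (- x)"]) auto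
  then show ?thesis
    unfolding tilt_def using \<open>t \<ge> 0\<close> by (intro cINF_lower) auto
qed

lemma tilt_greatest:
  assumes "\<And>t. t \<ge> 0 \<Longrightarrow> c \<le> p (x + t *\<^sub>R y) - t * p y"
  shows "c \<le> tilt p y x"
  unfolding tilt_def using assms by (intro cINF_greatest) auto

text \<open>Both properties come from reparametrising the half-line: parameters \<open>s\<close> and
  \<open>t\<close> for the two summands combine to \<open>s + t\<close>, and scaling the argument by
  \<open>t\<close> corresponds to scaling the parameter by \<open>t\<close>.\<close>

lemma sublinear_tilt:
  assumes p: "sublinear p"
  shows "sublinear (tilt p y)"
proof (rule sublinearI)
  fix x x'
  have *: "tilt p y (x + x') \<le> (p (x + s *\<^sub>R y) - s * p y) + (p (x' + t *\<^sub>R y) - t * p y)"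
    if "s \<ge> 0" "t \<ge> 0" for s t
    using tilt_le[OF p, of "s + t" y "x + x'"] that
      sublinear_add[OF p, of "x + s *\<^sub>R y" "x' + t *\<^sub>R y"]
    by (simp add: algebra_simps)
  \<comment> \<open>The infimum is taken in one parameter at a time: over \<open>t\<close> here with
    \<open>s\<close> fixed, then over \<open>s\<close>.\<close>
  have "tilt p y (x + x') - (p (x + s *\<^sub>R y) - s * p y) \<le> tilt p y x'" if "s \<ge> 0" for s
    by (rule tilt_greatest) (use *[OF that] in \<open>simp add: algebra_simps\<close>)
  then have "tilt p y (x + x') - tilt p y x' \<le> tilt p y x"
    by (intro tilt_greatest) (simp add: algebra_simps)
  then show "tilt p y (x + x') \<le> tilt p y x + tilt p y x'"
    by simp
next
  show "tilt p y 0 = 0"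
    using tilt_le[OF p, of 0 y 0] tilt_greatest[of 0 p 0 y]
    by (simp add: sublinear_scale[OF p] sublinear_zero[OF p])
next
  fix t :: real and x assume t: "t > 0"
  have "inverse t * tilt p y (t *\<^sub>R x) \<le> tilt p y x"
  proof (rule tilt_greatest)
    fix s :: real assume s: "s \<ge> 0"
    have "p (t *\<^sub>R x + (t * s) *\<^sub>R y) = t * p (x + s *\<^sub>R y)"
      using sublinear_scale[OF p, of t "x + s *\<^sub>R y"] t by (simp add: scaleR_right_distrib)
    then show "inverse t * tilt p y (t *\<^sub>R x) \<le> p (x + s *\<^sub>R y) - s * p y"
      using tilt_le[OF p, of "t * s" y "t *\<^sub>R x"] s t by (simp add: field_simps)
  qed
  then show "tilt p y (t *\<^sub>R x) \<le> t * tilt p y x"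
    using t by (simp add: field_simps)
qed

text \<open>An infimum of sublinear functions need not be subadditive. In a chain it is, because two
  members \<open>q\<close> and \<open>r\<close> have a common lower member whose own subadditivity
  applies. The bound \<open>p\<close> from above also gives the bound \<open>- p (- x)\<close> from
  below, so the infima are finite.\<close>

lemma sublinear_INF_chain:
  assumes "C \<noteq> {}" and sub: "\<And>q. q \<in> C \<Longrightarrow> sublinear q \<and> q \<le> p"
    and chain: "\<And>q r. q \<in> C \<Longrightarrow> r \<in> C \<Longrightarrow> q \<le> r \<or> r \<le> q"
  defines "g \<equiv> \<lambda>x. INF q\<in>C. q x"
  shows "sublinear g" and "\<And>q. q \<in> C \<Longrightarrow> g \<le> q"
proof -
  have bdd: "bdd_below ((\<lambda>q. q x) ` C)" for x
  proof (rule bdd_belowI2)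
    fix q assume "q \<in> C"
    with sub have "- p (- x) \<le> - q (- x)" "- q (- x) \<le> q x"
      by (auto simp: le_fun_def sublinear_minus)
    then show "- p (- x) \<le> q x" by linarith
  qed
  have le: "g x \<le> q x" if "q \<in> C" for q x
    unfolding g_def using bdd that by (rule cINF_lower)
  have greatest: "c \<le> g x" if "\<And>q. q \<in> C \<Longrightarrow> c \<le> q x" for c x
    unfolding g_def using \<open>C \<noteq> {}\<close> that by (rule cINF_greatest)
  show "g \<le> q" if "q \<in> C" for q using le[OF that] by (simp add: le_fun_def)
  show "sublinear g"
  proof (rule sublinearI)
    fix x y
    have *: "g (x + y) \<le> q x + r y" if qr: "q \<in> C" "r \<in> C" for q r
    proof -
      obtain s where s: "s \<in> C" "s \<le> q" "s \<le> r" using chain[OF qr] qr by blast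
      then show ?thesis
        using le[OF s(1), of "x + y"] sublinear_add[of s x y] sub[OF s(1)]
          le_funD[OF s(2), of x] le_funD[OF s(3), of y] by linarith
    qed
    have "g (x + y) - q x \<le> g y" if "q \<in> C" for q
      by (rule greatest) (use *[OF that] in \<open>simp add: algebra_simps\<close>)
    then have "g (x + y) - g y \<le> g x"
      by (intro greatest) (simp add: algebra_simps)
    then show "g (x + y) \<le> g x + g y" by simp
  next
    obtain q where "q \<in> C" using \<open>C \<noteq> {}\<close> by auto
    then show "g 0 = 0"
      using le[of q 0] greatest[of 0 0] sub by (auto simp: sublinear_zero)
  next
    fix t :: real and x assume t: "t > 0"
    have "inverse t * g (t *\<^sub>R x) \<le> g x"
    proof (rule greatest)
      fix q assume q: "q \<in> C"
      have "q (t *\<^sub>R x) = t * q x" using sub[OF q] t by (simp add: sublinear_scale)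
      with le[OF q, of "t *\<^sub>R x"] show "inverse t * g (t *\<^sub>R x) \<le> q x"
        using t by (simp add: field_simps)
    qed
    then show "g (t *\<^sub>R x) \<le> t * g x" using t by (simp add: field_simps)
  qed
qed

text \<open>Hahn-Banach without a prescribed functional on a subspace: Zorn's lemma supplies a
  minimal sublinear function below \<open>p\<close>, and minimality under tilting makes it additive,
  hence odd, hence homogeneous for negative scalars too.\<close>

theorem sublinear_dominates_linear:
  fixes p :: "'a::real_vector \<Rightarrow> real"
  assumes p: "sublinear p"
  obtains l where "linear l" "l \<le> p"
proof -
  define S where "S = {q. sublinear q \<and> q \<le> p}"
  \<comment> \<open>The pointwise order is reversed, so that the maximal element given by Zorn's
    lemma is a minimal sublinear function.\<close>
  define P where "P = (\<lambda>q r :: 'a \<Rightarrow> real. r \<le> q)"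
  have "\<exists>m\<in>S. \<forall>q\<in>S. P m q \<longrightarrow> q = m"
  proof (rule predicate_Zorn)
    show "partial_order_on S (relation_of P S)"
      unfolding P_def by (rule partial_order_on_relation_ofI) auto
  next
    fix C assume C: "C \<in> Chains (relation_of P S)"
    have CS: "C \<subseteq> S" and chain: "\<And>q r. q \<in> C \<Longrightarrow> r \<in> C \<Longrightarrow> q \<le> r \<or> r \<le> q"
      using C by (auto simp: Chains_def relation_of_def P_def)
    show "\<exists>u\<in>S. \<forall>a\<in>C. P a u"
    proof (cases "C = {}")
      case True
      then show ?thesis using p by (auto simp: S_def)
    next
      case False
      have sub: "\<And>q. q \<in> C \<Longrightarrow> sublinear q \<and> q \<le> p" using CS by (auto simp: S_def)
      note g = sublinear_INF_chain[OF False sub chain]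
      obtain q where "q \<in> C" using False by auto
      then have "(\<lambda>x. INF q\<in>C. q x) \<in> S"
        using g(1) order_trans[OF g(2)[of q], of p] sub by (auto simp: S_def)
      with g(2) show ?thesis by (auto simp: P_def)
    qed
  qed
  then obtain q where q: "sublinear q" "q \<le> p"
    and min: "\<And>r. sublinear r \<Longrightarrow> r \<le> q \<Longrightarrow> r = q"
    by (auto simp: S_def P_def)
  have tilt: "tilt q y = q" for y
    by (rule min[OF sublinear_tilt[OF q(1)]])
      (use tilt_le[OF q(1), of 0] in \<open>simp add: le_fun_def\<close>)
  have add: "q (x + y) = q x + q y" for x y
    using tilt_le[OF q(1), of 1 y x] sublinear_add[OF q(1), of x y] by (simp add: tilt)
  have minus: "q (- x) = - q x" for x
    using add[of x "- x"] by (simp add: sublinear_zero[OF q(1)])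
  have scale: "q (t *\<^sub>R x) = t * q x" for t x
  proof (cases "t \<ge> 0")
    case False
    then have "q ((- t) *\<^sub>R x) = (- t) * q x"
      by (intro sublinear_scale[OF q(1)]) simp
    then show ?thesis by (simp add: minus)
  qed (simp add: sublinear_scale[OF q(1)])
  show thesis
    by (rule that[of q]) (auto intro!: linearI add scale simp: q(2))
qed

text \<open>A linear functional below the norm itself could be zero. Below the tilted norm,
  parameter 0 still gives domination by the norm, while parameter 1 at \<open>- a\<close> pins down
  the value at \<open>a\<close>.\<close>

theorem exists_norming_functional:
  fixes a :: "'a::real_normed_vector"
  obtains l :: "'a \<Rightarrow>\<^sub>L real" where "\<And>x. \<bar>l x\<bar> \<le> norm x" "l a = norm a"
proof -
  have n: "sublinear (norm :: 'a \<Rightarrow> real)"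
    by (rule sublinearI) (auto intro: norm_triangle_ineq)
  obtain l where l: "linear l" "l \<le> tilt norm a"
    using sublinear_dominates_linear[OF sublinear_tilt[OF n]] .
  have le: "l x \<le> norm x" for x
    using le_funD[OF l(2), of x] tilt_le[OF n, of 0 a x] by simp
  have abs: "\<bar>l x\<bar> \<le> norm x" for x
    using le[of x] le[of "- x"] by (simp add: linear_neg[OF l(1)])
  have "l (- a) \<le> - norm a"
    using le_funD[OF l(2), of "- a"] tilt_le[OF n, of 1 a "- a"] by simp
  then have eq: "l a = norm a"
    using le[of a] by (simp add: linear_neg[OF l(1)])
  have "bounded_linear l"
    using l(1) abs by (intro bounded_linear_intro[of l 1]) (auto simp: linear_add linear_scale)
  then show thesis
    using that[of "Blinfun l"] abs eq by (simp add: bounded_linear_Blinfun_apply)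
qed

subsection \<open>Separability\<close>

text \<open>A maximal set of points at mutual distance at least \<open>e\<close> is an
  \<open>e\<close>-net. The balls of radius \<open>e/2\<close> about its points are disjoint and
  have positive mass, so a finite measure leaves room for only countably many. Nets for the radii
  \<open>1 / Suc n\<close> together form a dense set.\<close>

lemma separable_if_nondegenerate:
  fixes \<mu> :: "'a::metric_space measure"
  assumes "finite_measure \<mu>" and sets: "sets \<mu> = sets borel" and "nondegenerate_measure \<mu>"
  obtains D :: "'a set" where "countable D" "closure D = UNIV"
proof -
  interpret finite_measure \<mu> by fact
  have space: "space \<mu> = UNIV" using sets_eq_imp_space_eq[OF sets] by simp
  have net: "\<exists>A. countable A \<and> (\<forall>x::'a. \<exists>a\<in>A. dist a x < e)" if "e > 0" for e :: real
  proof -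
    define S where "S = {A :: 'a set. \<forall>x\<in>A. \<forall>y\<in>A. x \<noteq> y \<longrightarrow> e \<le> dist x y}"
    have "\<exists>A\<in>S. \<forall>B\<in>S. A \<subseteq> B \<longrightarrow> B = A"
    proof (rule subset_Zorn')
      fix C assume C: "subset.chain S C"
      then have CS: "C \<subseteq> S" by (simp add: subset.chain_def)
      show "\<Union>C \<in> S"
        unfolding S_def
      proof safe
        fix x y X Y assume xy: "x \<in> X" "X \<in> C" "y \<in> Y" "Y \<in> C" "x \<noteq> y"
        then have "X \<subseteq> Y \<or> Y \<subseteq> X"
          using C unfolding subset_chain_def by blast
        then obtain Z where "Z \<in> C" "x \<in> Z" "y \<in> Z" using xy by blast
        then show "e \<le> dist x y" using CS xy by (auto simp: S_def)
      qed
    qed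
    then obtain A where A: "A \<in> S" and max: "\<And>B. B \<in> S \<Longrightarrow> A \<subseteq> B \<Longrightarrow> B = A" by blast
    have near: "\<exists>a\<in>A. dist a x < e" for x
    proof (rule ccontr)
      assume neg: "\<not> (\<exists>a\<in>A. dist a x < e)"
      then have "insert x A \<in> S" using A by (auto simp: S_def dist_commute not_less)
      then have "x \<in> A" using max[of "insert x A"] by blast
      then show False using neg \<open>e > 0\<close> by auto
    qed
    \<comment> \<open>Sending each point to the centre of the ball containing it turns the balls into atoms of
      a finite discrete measure, and there are only countably many of those.\<close>
    define g where "g x = (if \<exists>a\<in>A. dist a x < e/2 then Some (SOME a. a \<in> A \<and> dist a x < e/2) else None)" for x
    have uniq: "a = b" if "a \<in> A" "b \<in> A" "dist a x < e/2" "dist b x < e/2" for a b x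
    proof (rule ccontr)
      assume "a \<noteq> b"
      then have "e \<le> dist a b" using A that by (auto simp: S_def)
      also have "\<dots> \<le> dist a x + dist b x" by (rule dist_triangle2)
      finally show False using that by simp
    qed
    have g: "g x = Some a \<longleftrightarrow> a \<in> A \<and> dist a x < e/2" for x a
    proof
      assume "g x = Some a"
      then have "\<exists>a\<in>A. dist a x < e/2" and "a = (SOME a. a \<in> A \<and> dist a x < e/2)"
        by (auto simp: g_def split: if_splits)
      then show "a \<in> A \<and> dist a x < e/2" by (auto intro: someI2)
    next
      assume a: "a \<in> A \<and> dist a x < e/2"
      then have "(SOME a. a \<in> A \<and> dist a x < e/2) = a"
        by (intro some_equality) (auto intro: uniq)
      then show "g x = Some a" using a by (auto simp: g_def)
    qed
    \<comment> \<open>A union of open balls is open however many there are, so measurability is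
      available before \<open>A\<close> is known to be countable. Sets containing
      \<open>None\<close> are then treated by complement.\<close>
    have vim: "g -` T \<in> sets \<mu>" if "None \<notin> T" for T
    proof -
      have "g -` T = (\<Union>a\<in>{a\<in>A. Some a \<in> T}. ball a (e/2))"
        using that g by (auto simp: mem_ball) (metis option.exhaust)+
      then show ?thesis unfolding sets by (simp add: open_UN)
    qed
    have meas: "g \<in> \<mu> \<rightarrow>\<^sub>M count_space UNIV"
    proof (rule measurableI)
      fix T assume "T \<in> sets (count_space (UNIV::'a option set))"
      show "g -` T \<inter> space \<mu> \<in> sets \<mu>"
      proof (cases "None \<in> T")
        case True
        then have "space \<mu> - g -` (- T) \<in> sets \<mu>" using vim[of "- T"] by (intro sets.compl_sets) auto
        then show ?thesis by (simp add: space vimage_Compl)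
      qed (use vim in \<open>simp add: space\<close>)
    qed simp
    interpret d: finite_measure "distr \<mu> (count_space UNIV) g"
      using meas by (rule finite_measure_distr)
    have "measure (distr \<mu> (count_space UNIV) g) {Some a} \<noteq> 0" if "a \<in> A" for a
    proof -
      have "g -` {Some a} = ball a (e/2)" using g that by (auto simp: mem_ball)
      then have "measure (distr \<mu> (count_space UNIV) g) {Some a} = measure \<mu> (ball a (e/2))"
        using measure_distr[OF meas, of "{Some a}"] by (simp add: space)
      moreover have "emeasure \<mu> (ball a (e/2)) > 0"
        using assms(3) \<open>e > 0\<close> unfolding nondegenerate_measure_def by (metis open_ball ball_eq_empty half_gt_zero not_less)
      ultimately show ?thesis by (simp add: emeasure_eq_measure)
    qed
    then have "Some ` A \<subseteq> {y. measure (distr \<mu> (count_space UNIV) g) {y} \<noteq> 0}" by auto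
    then have "countable (Some ` A)" using d.countable_support countable_subset by blast
    then have "countable A" by (simp add: countable_image_inj_eq)
    then show ?thesis using near by blast
  qed
  have "\<exists>A. countable A \<and> (\<forall>x::'a. \<exists>a\<in>A. dist a x < inverse (real (Suc n)))" for n
    by (rule net) simp
  then obtain A where A: "\<And>n. countable (A n)"
      "\<And>n x::'a. \<exists>a\<in>A n. dist a x < inverse (real (Suc n))"
    by metis
  show thesis
  proof (rule that[of "\<Union>n. A n"])
    show "closure (\<Union>n. A n) = UNIV"
    proof (intro set_eqI iffI UNIV_I)
      fix x :: 'a
      show "x \<in> closure (\<Union>n. A n)"
        unfolding closure_approachable
      proof safe
        fix e :: real assume "e > 0"
        then obtain n where "inverse (real (Suc n)) < e" using reals_Archimedean by blast
        then show "\<exists>y\<in>\<Union>n. A n. dist y x < e" using A(2)[of n x] by (auto intro: less_trans)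
      qed
    qed
  qed (use A(1) in auto)
qed

text \<open>Norming functionals at the points of a countable dense set determine the norm as a
  countable supremum. Hence closed balls have measurable preimages, and every open set is a
  countable union of closed balls.\<close>

lemma measurable_if_functionals_measurable:
  fixes g :: "'b \<Rightarrow> 'a::real_normed_vector"
  assumes D: "countable D" "closure D = (UNIV :: 'a set)"
    and meas: "\<And>l :: 'a \<Rightarrow>\<^sub>L real. (\<lambda>x. l (g x)) \<in> borel_measurable N"
  shows "g \<in> borel_measurable N"
proof (rule borel_measurableI)
  have approx: "\<exists>d\<in>D. dist d x < e" if "e > 0" for x e
    using D(2) closure_approachable[of x D] that by auto
  have "\<exists>l :: 'a \<Rightarrow>\<^sub>L real. (\<forall>x. \<bar>l x\<bar> \<le> norm x) \<and> l d = norm d" for d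
    using exists_norming_functional[of d] by metis
  then obtain l :: "'a \<Rightarrow> 'a \<Rightarrow>\<^sub>L real"
    where l: "\<And>d x. \<bar>l d x\<bar> \<le> norm x" "\<And>d. l d d = norm d"
    by metis
  have norm_le: "norm x \<le> r \<longleftrightarrow> (\<forall>d\<in>D. \<bar>l d x\<bar> \<le> r)" for x r
  proof
    assume *: "\<forall>d\<in>D. \<bar>l d x\<bar> \<le> r"
    show "norm x \<le> r"
    proof (rule field_le_epsilon)
      fix e :: real assume "e > 0"
      then obtain d where d: "d \<in> D" "dist d x < e/2" using approx[of "e/2" x] by auto
      have "norm x \<le> norm d + dist d x"
        using norm_triangle_sub[of x d] by (simp add: dist_norm norm_minus_commute)
      also have "norm d = l d (d - x) + l d x" by (simp add: l blinfun.diff_right)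
      also have "\<dots> \<le> dist d x + r"
        using l(1)[of d "d - x"] * d(1) by (fastforce simp: dist_norm)
      finally show "norm x \<le> r + e" using d by simp
    qed
  qed (use l(1) order_trans in blast)
  have cball: "g -` cball a r \<inter> space N \<in> sets N" for a r
  proof -
    have "g x \<in> cball a r \<longleftrightarrow> (\<forall>d\<in>D. \<bar>l d (g x) - l d a\<bar> \<le> r)" for x
      unfolding mem_cball dist_norm norm_le by (simp add: blinfun.diff_right abs_minus_commute)
    then have "g -` cball a r \<inter> space N = {x\<in>space N. \<forall>d\<in>D. \<bar>l d (g x) - l d a\<bar> \<le> r}"
      by auto
    also have "\<dots> \<in> sets N"
      using D(1) meas by (intro sets.sets_Collect_countable_All') measurable
    finally show ?thesis .
  qed
  fix S :: "'a set" assume S: "open S"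
  define I where "I = {(d, q). d \<in> D \<and> q \<in> \<rat> \<and> cball d q \<subseteq> S}"
  have "countable I"
    by (rule countable_subset[of _ "D \<times> \<rat>"]) (use D(1) countable_rat in \<open>auto simp: I_def\<close>)
  have "S = (\<Union>i\<in>I. cball (fst i) (snd i))"
  proof (intro equalityI subsetI)
    fix x assume "x \<in> S"
    then obtain e where e: "e > 0" "cball x e \<subseteq> S" using S open_contains_cball by blast
    \<comment> \<open>A centre within \<open>q\<close> of \<open>x\<close> puts \<open>x\<close>
      into the ball, and \<open>2 * q < e\<close> keeps the ball inside
      \<open>cball x e\<close>.\<close>
    obtain q where q: "q \<in> \<rat>" "0 < q" "q < e/2" using Rats_dense_in_real[of 0 "e/2"] e by auto
    obtain d where d: "d \<in> D" "dist d x < q" using approx q by blast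
    have "cball d q \<subseteq> cball x e"
      using d q by (intro subsetI) (smt (verit) mem_cball dist_commute dist_triangle field_sum_of_halves)
    then have "(d, q) \<in> I" using d q e by (auto simp: I_def)
    then show "x \<in> (\<Union>i\<in>I. cball (fst i) (snd i))" using d by (auto intro!: bexI[of _ "(d, q)"])
  qed (auto simp: I_def)
  then have *: "g -` S \<inter> space N = (\<Union>i\<in>I. g -` cball (fst i) (snd i) \<inter> space N)"
    by auto
  show "g -` S \<inter> space N \<in> sets N"
    unfolding * by (intro sets.countable_UN'' \<open>countable I\<close> cball)
qed

subsection \<open>Uniqueness of measures with given characteristic functional\<close>

text \<open>Normalising the weight turns \<open>w\<close> into a probability density.
  \<open>P\<close> is the law of \<open>l\<close> under it, and its characteristic function is
  recorded by real cosine and sine integrals.\<close>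

lemma weighted_distr_char:
  fixes w l :: "'b \<Rightarrow> real"
  assumes "finite_measure \<mu>" and [measurable]: "w \<in> borel_measurable \<mu>" "l \<in> borel_measurable \<mu>"
    and w: "\<And>x. 0 \<le> w x" "\<And>x. w x \<le> K"
    and c: "c = (\<integral>x. w x \<partial>\<mu>)" "c > 0"
  defines "P \<equiv> distr (density \<mu> (\<lambda>x. ennreal (w x / c))) borel l"
  shows "real_distribution P"
    and "char P t = Complex ((\<integral>x. w x * cos (t * l x) \<partial>\<mu>) / c) ((\<integral>x. w x * sin (t * l x) \<partial>\<mu>) / c)"
    and "A \<in> sets borel \<Longrightarrow> measure P A = (\<integral>x. w x * indicator A (l x) \<partial>\<mu>) / c"
proof -
  interpret finite_measure \<mu> by fact
  have int: "integrable \<mu> (\<lambda>x. w x * g x)" if [measurable]: "g \<in> borel_measurable \<mu>" "\<And>x. \<bar>g x\<bar> \<le> 1" for g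
  proof (rule integrable_const_bound[of _ K])
    have "\<bar>w x\<bar> * \<bar>g x\<bar> \<le> K * 1" for x
      using w[of x] that(2)[of x] by (intro mult_mono) auto
    then show "AE x in \<mu>. norm (w x * g x) \<le> K" by (simp add: abs_mult)
  qed simp
  have intw: "integrable \<mu> w" using int[of "\<lambda>_. 1"] by simp
  have "emeasure (density \<mu> (\<lambda>x. ennreal (w x / c))) (space \<mu>) = (\<integral>\<^sup>+x. ennreal (w x / c) \<partial>\<mu>)"
    by (subst emeasure_density) (auto intro!: nn_integral_cong)
  also have "\<dots> = ennreal (\<integral>x. w x / c \<partial>\<mu>)"
    using w c by (intro nn_integral_eq_integral) (auto intro: intw)
  also have "\<dots> = 1" using c by simp
  finally have prob: "prob_space (density \<mu> (\<lambda>x. ennreal (w x / c)))"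
    by (intro prob_spaceI) simp
  show rd: "real_distribution P"
    unfolding P_def by (rule prob_space.real_distribution_distr[OF prob]) simp
  have "char P t = (\<integral>x. (w x / c) *\<^sub>R cis (t * l x) \<partial>\<mu>)"
    unfolding char_def P_def using w c
    by (subst integral_distr, simp, simp, subst integral_density) (auto simp: cis_conv_exp mult_ac)
  moreover have "integrable \<mu> (\<lambda>x. (w x / c) *\<^sub>R cis (t * l x))"
  proof (rule integrable_const_bound[of _ "K / c"])
    show "AE x in \<mu>. norm ((w x / c) *\<^sub>R cis (t * l x)) \<le> K / c"
      using w c by (auto simp: divide_simps)
    show "(\<lambda>x. (w x / c) *\<^sub>R cis (t * l x)) \<in> borel_measurable \<mu>"
      unfolding cis_conv_exp by measurable
  qed
  ultimately show "char P t = Complex ((\<integral>x. w x * cos (t * l x) \<partial>\<mu>) / c) ((\<integral>x. w x * sin (t * l x) \<partial>\<mu>) / c)"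
    by (intro complex_eqI) (simp_all flip: integral_Re integral_Im)
  show "measure P A = (\<integral>x. w x * indicator A (l x) \<partial>\<mu>) / c" if [measurable]: "A \<in> sets borel"
  proof -
    interpret P: real_distribution P by fact
    have "measure P A = (\<integral>y. indicator A y \<partial>P)" by simp
    also have "\<dots> = (\<integral>x. (w x / c) *\<^sub>R indicator A (l x) \<partial>\<mu>)"
      unfolding P_def using w c
      by (subst integral_distr, simp, simp, subst integral_density) auto
    finally show ?thesis by simp
  qed
qed

text \<open>The phases 0 and \<open>- (pi / 2)\<close> give the real and imaginary parts of the
  characteristic function of \<open>l\<close> under the weight \<open>w\<close>, so Levy's theorem
  applies when the total weight \<open>c\<close> is positive. Otherwise \<open>c\<close> is 0 and
  both sides are squeezed to 0.\<close>

lemma weighted_integral_indicator_eq: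
  fixes w l :: "'b \<Rightarrow> real"
  assumes fin: "finite_measure \<mu>" "finite_measure \<nu>" and sets: "sets \<mu> = sets \<nu>"
    and meas: "w \<in> borel_measurable \<mu>" "l \<in> borel_measurable \<mu>"
    and w: "\<And>x. 0 \<le> w x" "\<And>x. w x \<le> K"
    and eq: "\<And>t b. (\<integral>x. w x * cos (t * l x + b) \<partial>\<mu>) = (\<integral>x. w x * cos (t * l x + b) \<partial>\<nu>)"
    and A[measurable]: "A \<in> sets borel"
  shows "(\<integral>x. w x * indicator A (l x) \<partial>\<mu>) = (\<integral>x. w x * indicator A (l x) \<partial>\<nu>)"
proof -
  note [measurable_cong] = sets
  note [measurable] = meas
  have meas\<nu>: "w \<in> borel_measurable \<nu>" "l \<in> borel_measurable \<nu>" by measurable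
  define c where "c = (\<integral>x. w x \<partial>\<mu>)"
  have c\<nu>: "c = (\<integral>x. w x \<partial>\<nu>)" using eq[of 0 0] by (simp add: c_def)
  show ?thesis
  proof (cases "c > 0")
    case True
    define Q where "Q \<kappa> = distr (density \<kappa> (\<lambda>x. ennreal (w x / c))) borel l" for \<kappa>
    note P = weighted_distr_char[OF fin(1) meas w c_def True, folded Q_def]
    note P' = weighted_distr_char[OF fin(2) meas\<nu> w c\<nu> True, folded Q_def]
    have sin: "sin x = cos (x + (- (pi / 2)))" for x :: real
      using cos_sin_eq[of x] cos_minus[of "pi/2 - x"] by (simp add: cos_diff)
    have "char (Q \<mu>) = char (Q \<nu>)"
      using eq[of _ 0] eq[of _ "- (pi / 2)"] unfolding P(2) P'(2) sin by (intro ext) simp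
    then have "Q \<mu> = Q \<nu>" by (rule Levy_uniqueness[OF P(1) P'(1)])
    then show ?thesis using P(3)[OF A] P'(3)[OF A] True by simp
  next
    case False
    have "(\<integral>x. w x * indicator A (l x) \<partial>\<kappa>) = 0"
      if "finite_measure \<kappa>" and [measurable]: "w \<in> borel_measurable \<kappa>" "l \<in> borel_measurable \<kappa>"
        and "c = (\<integral>x. w x \<partial>\<kappa>)" for \<kappa>
    proof -
      interpret finite_measure \<kappa> by fact
      have int: "integrable \<kappa> w" using w by (intro integrable_const_bound[of _ K]) auto
      have "(\<integral>x. w x * indicator A (l x) \<partial>\<kappa>) \<le> (\<integral>x. w x \<partial>\<kappa>)"
        using w by (intro integral_mono' int) (auto simp: indicator_def)
      moreover have "0 \<le> (\<integral>x. w x * indicator A (l x) \<partial>\<kappa>)"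
        using w by simp
      ultimately show ?thesis using False that by linarith
    qed
    from this[OF fin(1) meas c_def] this[OF fin(2) meas\<nu> c\<nu>] show ?thesis by simp
  qed
qed

text \<open>A Cramer-Wold argument built on the one-dimensional uniqueness theorem alone: equality
  of the cosine integrals is carried over from the whole space to smaller sets, one functional at a
  time, until every set of the generated sigma-algebra is reached.\<close>

theorem measure_eqI_cos_integrals:
  fixes F :: "('b \<Rightarrow> real) set"
  assumes fin: "finite_measure \<mu>" "finite_measure \<nu>" and sets: "sets \<mu> = sets \<nu>"
    and F: "F \<noteq> {}" "\<And>f. f \<in> F \<Longrightarrow> f \<in> borel_measurable \<mu>"
      "\<And>f g s t. f \<in> F \<Longrightarrow> g \<in> F \<Longrightarrow> (\<lambda>x. s * f x + t * g x) \<in> F"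
    and gen: "sets \<mu> \<subseteq> sigma_sets (space \<mu>) {f -` A \<inter> space \<mu> | f A. f \<in> F \<and> A \<in> sets borel}"
    and eq: "\<And>f b. f \<in> F \<Longrightarrow> (\<integral>x. cos (f x + b) \<partial>\<mu>) = (\<integral>x. cos (f x + b) \<partial>\<nu>)"
  shows "\<mu> = \<nu>"
proof -
  note [measurable_cong] = sets
  interpret \<mu>: finite_measure \<mu> by fact
  interpret \<nu>: finite_measure \<nu> by fact
  have space: "space \<mu> = space \<nu>" by (rule sets_eq_imp_space_eq[OF sets])
  define I where "I S f b \<kappa> = (\<integral>x. indicator S x * cos (f x + b) \<partial>\<kappa>)"
    for S and f :: "'b \<Rightarrow> real" and b :: real and \<kappa> :: "'b measure"
  \<comment> \<open>The good sets are closed under intersection with each \<open>l -` A\<close>: the weight \<open>2 + cos (m x + b)\<close>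
    is positive, so Levy's one-dimensional uniqueness theorem applies to the law of \<open>l\<close> under it.\<close>
  define good where "good S \<longleftrightarrow> S \<in> sets \<mu> \<and> (\<forall>f\<in>F. \<forall>b. I S f b \<mu> = I S f b \<nu>)" for S
  have int: "integrable \<mu> (\<lambda>x. indicator S x * cos (f x + b))"
      "integrable \<nu> (\<lambda>x. indicator S x * cos (f x + b))"
    if "S \<in> sets \<mu>" "f \<in> F" for S f b
  proof -
    note [measurable] = F(2)[OF that(2)] that(1)
    show "integrable \<mu> (\<lambda>x. indicator S x * cos (f x + b))"
      by (rule \<mu>.integrable_const_bound[of _ 1]) (auto simp: indicator_def)
    show "integrable \<nu> (\<lambda>x. indicator S x * cos (f x + b))"
      by (rule \<nu>.integrable_const_bound[of _ 1]) (auto simp: indicator_def)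
  qed
  have basic: "good (S \<inter> (l -` A \<inter> space \<mu>))"
    if S: "good S" and l: "l \<in> F" and A[measurable]: "A \<in> sets borel" for S l A
  proof -
    note [measurable] = F(2)
    have S\<mu>[measurable]: "S \<in> sets \<mu>" using S by (simp add: good_def)
    have [measurable]: "l \<in> borel_measurable \<mu>" using l F by blast
    have "I (S \<inter> (l -` A \<inter> space \<mu>)) m b \<mu> = I (S \<inter> (l -` A \<inter> space \<mu>)) m b \<nu>" if m: "m \<in> F" for m b
    proof -
      have [measurable]: "m \<in> borel_measurable \<mu>" using m F by blast
      define J where "J b \<kappa> = (\<integral>x. indicator S x * (2 + cos (m x + b)) * indicator A (l x) \<partial>\<kappa>)"
        for b :: real and \<kappa> :: "'b measure"
      have J: "J b \<mu> = J b \<nu>" for b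
        unfolding J_def
      proof (rule weighted_integral_indicator_eq[OF fin sets, where K = 3])
        fix x show "0 \<le> indicator S x * (2 + cos (m x + b))"
          using cos_ge_minus_one[of "m x + b"] unfolding indicator_def by (auto simp del: cos_ge_minus_one)
        show "indicator S x * (2 + cos (m x + b)) \<le> 3"
          using cos_le_one[of "m x + b"] by (auto simp: indicator_def)
      next
        fix t d :: real
        \<comment> \<open>By the product-to-sum formula the weighted integral splits into cosine
          integrals of \<open>t l\<close>, \<open>t l + m\<close> and \<open>t l - m\<close>. The
          coefficients 0 and 1 stay visible so that closure of \<open>F\<close> under linear
          combinations matches literally.\<close>
        let ?f = "\<lambda>x. t * l x + 0 * l x" and ?g = "\<lambda>x. t * l x + 1 * m x" and ?h = "\<lambda>x. t * l x + (-1) * m x"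
        have fgh: "?f \<in> F" "?g \<in> F" "?h \<in> F" using l m F(3) by blast+
        have "(\<integral>x. indicator S x * (2 + cos (m x + b)) * cos (t * l x + d) \<partial>\<kappa>) =
            2 * I S ?f d \<kappa> + I S ?g (b + d) \<kappa> / 2 + I S ?h (d - b) \<kappa> / 2"
          if int: "\<And>f b. f \<in> F \<Longrightarrow> integrable \<kappa> (\<lambda>x. indicator S x * cos (f x + b))" for \<kappa>
        proof -
          have "cos (t * l x + d) * cos (m x + b) =
              (cos (?h x + (d - b)) + cos (?g x + (b + d))) / 2" for x
            using cos_times_cos[of "t * l x + d" "m x + b"] by (simp add: algebra_simps)
          then have "indicator S x * (2 + cos (m x + b)) * cos (t * l x + d) =
              2 * (indicator S x * cos (?f x + d)) + indicator S x * cos (?g x + (b + d)) / 2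
                + indicator S x * cos (?h x + (d - b)) / 2" for x
            by (auto simp: indicator_def algebra_simps add_divide_distrib)
          then show ?thesis
            unfolding I_def using int[OF fgh(1)] int[OF fgh(2)] int[OF fgh(3)]
            by (simp del: mult_zero_left mult_1 add_0_right)
        qed
        from this[of \<mu>] this[of \<nu>]
        show "(\<integral>x. indicator S x * (2 + cos (m x + b)) * cos (t * l x + d) \<partial>\<mu>) =
            (\<integral>x. indicator S x * (2 + cos (m x + b)) * cos (t * l x + d) \<partial>\<nu>)"
          using S fgh int[OF S\<mu>] by (simp add: good_def)
      qed measurable
      \<comment> \<open>Shifting the phase by \<open>pi\<close> flips the sign of the cosine, so the
        difference of the two weights cancels the constant 2 and leaves
        \<open>2 * cos (m x + b)\<close>.\<close>
      have "I (S \<inter> (l -` A \<inter> space \<mu>)) m b \<kappa> = (J b \<kappa> - J (b + pi) \<kappa>) / 2"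
        if [measurable_cong]: "sets \<kappa> = sets \<mu>" and "finite_measure \<kappa>" for \<kappa>
      proof -
        interpret finite_measure \<kappa> by fact
        have sp: "space \<kappa> = space \<mu>" using that sets_eq_imp_space_eq by blast
        have intJ: "integrable \<kappa> (\<lambda>x. indicator S x * (2 + cos (m x + b)) * indicator A (l x))" for b
          by (rule integrable_const_bound[of _ 3])
            (auto simp: indicator_def intro!: order_trans[OF abs_triangle_ineq])
        have "I (S \<inter> (l -` A \<inter> space \<mu>)) m b \<kappa> =
          (\<integral>x. (indicator S x * (2 + cos (m x + b)) * indicator A (l x)
             - indicator S x * (2 + cos (m x + (b + pi))) * indicator A (l x)) / 2 \<partial>\<kappa>)"
          unfolding I_def by (intro Bochner_Integration.integral_cong refl)
            (auto simp: indicator_def sp add.assoc[symmetric])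
        then show ?thesis using intJ[of b] intJ[of "b + pi"] by (simp add: J_def)
      qed
      from this[OF refl fin(1)] this[OF sets[symmetric] fin(2)] show ?thesis
        using J by simp
    qed
    then show ?thesis by (simp add: good_def)
  qed
  have diff: "good (S - T)" if "good S" "good (S \<inter> T)" "T \<in> sets \<mu>" for S T
  proof -
    have [measurable]: "S \<in> sets \<mu>" "T \<in> sets \<mu>" using that by (auto simp: good_def)
    have "I (S - T) f b \<kappa> = I S f b \<kappa> - I (S \<inter> T) f b \<kappa>"
      if "\<And>S. S \<in> sets \<mu> \<Longrightarrow> integrable \<kappa> (\<lambda>x. indicator S x * cos (f x + b))" for f b \<kappa>
    proof -
      have "I (S - T) f b \<kappa> =
          (\<integral>x. indicator S x * cos (f x + b) - indicator (S \<inter> T) x * cos (f x + b) \<partial>\<kappa>)"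
        unfolding I_def by (intro Bochner_Integration.integral_cong refl) (auto simp: indicator_def)
      also have "\<dots> = I S f b \<kappa> - I (S \<inter> T) f b \<kappa>"
        unfolding I_def by (intro Bochner_Integration.integral_diff that) auto
      finally show ?thesis .
    qed
    then have "I (S - T) f b \<mu> = I (S - T) f b \<nu>" if "f \<in> F" for f b
      using \<open>good S\<close> \<open>good (S \<inter> T)\<close> int that by (simp add: good_def)
    then show ?thesis by (simp add: good_def)
  qed
  \<comment> \<open>The induction is over \<open>T\<close> with all good \<open>S\<close> quantified
    inside, since the union case intersects sets that have already been cut down.\<close>
  have inter: "T \<in> sets \<mu> \<and> (\<forall>S. good S \<longrightarrow> good (S \<inter> T))"
    if "T \<in> sigma_sets (space \<mu>) {f -` A \<inter> space \<mu> | f A. f \<in> F \<and> A \<in> sets borel}" for T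
    using that
  proof (induction rule: sigma_sets.induct)
    case (Basic T)
    then show ?case using basic F(2) by (auto intro: measurable_sets)
  next
    case Empty
    then show ?case by (auto simp: good_def I_def)
  next
    case (Compl T)
    have "S \<inter> (space \<mu> - T) = S - T" if "good S" for S
      using that sets.sets_into_space[of S \<mu>] by (auto simp: good_def)
    then show ?case using Compl.IH diff by auto
  next
    case (Union T)
    have T[measurable]: "\<And>i. T i \<in> sets \<mu>" using Union.IH by blast
    have "good (S \<inter> (\<Union>i. T i))" if S: "good S" for S
    proof -
      have [measurable]: "S \<in> sets \<mu>" using S by (simp add: good_def)
      \<comment> \<open>The \<open>T i\<close> need not be disjoint; removing them successively
        keeps the set good at each stage, and dominated convergence passes to the full
        union.\<close>
      have fin_un: "good (S - (\<Union>i<n. T i))" for n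
      proof (induction n)
        case (Suc n)
        have "S - (\<Union>i<Suc n. T i) = (S - (\<Union>i<n. T i)) - T n" by (auto simp: less_Suc_eq)
        then show ?case using diff[OF Suc _ T] Union.IH Suc by auto
      qed (use S in simp)
      have lim: "(\<lambda>n. I (S - (\<Union>i<n. T i)) f b \<kappa>) \<longlonglongrightarrow> I (S - (\<Union>i. T i)) f b \<kappa>"
        if "f \<in> F" "finite_measure \<kappa>" and [measurable_cong]: "sets \<kappa> = sets \<mu>" for f b \<kappa>
      proof -
        interpret finite_measure \<kappa> by fact
        have [measurable]: "f \<in> borel_measurable \<mu>" using that F by blast
        show ?thesis
          unfolding I_def
        proof (rule integral_dominated_convergence[where w = "\<lambda>_. 1"])
          show "AE x in \<kappa>. (\<lambda>n. indicator (S - (\<Union>i<n. T i)) x * cos (f x + b))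
              \<longlonglongrightarrow> indicator (S - (\<Union>i. T i)) x * cos (f x + b)"
          proof (intro AE_I2 tendsto_eventually)
            fix x
            show "\<forall>\<^sub>F n in sequentially. indicator (S - (\<Union>i<n. T i)) x * cos (f x + b)
              = indicator (S - (\<Union>i. T i)) x * cos (f x + b)"
            proof (cases "\<exists>i. x \<in> T i")
              case True
              then obtain i where "x \<in> T i" by blast
              then show ?thesis
                by (intro eventually_mono[OF eventually_gt_at_top[of i]]) (auto simp: indicator_def)
            qed (simp add: indicator_def)
          qed
        qed (auto simp: indicator_def)
      qed
      have "I (S - (\<Union>i. T i)) f b \<mu> = I (S - (\<Union>i. T i)) f b \<nu>" if "f \<in> F" for f b
      proof (rule LIMSEQ_unique[OF lim[OF that fin(1) refl]])
        show "(\<lambda>n. I (S - (\<Union>i<n. T i)) f b \<mu>) \<longlonglongrightarrow> I (S - (\<Union>i. T i)) f b \<nu>"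
          using lim[OF that fin(2) sets[symmetric], of b] fin_un that by (simp add: good_def)
      qed
      then have "good (S - (\<Union>i. T i))" by (simp add: good_def)
      then have "good (S - (S - (\<Union>i. T i)))"
        using S by (intro diff) (auto simp: Int_absorb1)
      then show ?thesis by (simp add: Diff_Diff_Int)
    qed
    then show ?case by auto
  qed
  obtain f where f: "f \<in> F" using F(1) by blast
  \<comment> \<open>With the zero function and phase 0, the cosine integral over a set is its
    measure.\<close>
  have zero: "(\<lambda>x. 0) \<in> F" using F(3)[OF f f, of 0 0] by simp
  have "good (space \<mu>)"
    using eq by (auto simp: good_def I_def space cong: Bochner_Integration.integral_cong)
      (metis (no_types, lifting) eq space indicator_simps(1) mult_1 Bochner_Integration.integral_cong)
  show ?thesis
  proof (rule measure_eqI[OF sets])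
    fix T assume T: "T \<in> sets \<mu>"
    have "good (space \<mu> \<inter> T)" using inter gen T \<open>good (space \<mu>)\<close> by blast
    moreover have "space \<mu> \<inter> T = T" using sets.sets_into_space[OF T] by blast
    ultimately have "I T (\<lambda>x. 0) 0 \<mu> = I T (\<lambda>x. 0) 0 \<nu>" using zero by (simp add: good_def)
    then have "measure \<mu> T = measure \<nu> T"
      using T sets.sets_into_space[OF T] space sets by (simp add: I_def Int_absorb1)
    then show "emeasure \<mu> T = emeasure \<nu> T"
      by (simp add: \<mu>.emeasure_eq_measure \<nu>.emeasure_eq_measure)
  qed
qed

subsection \<open>Rotation invariance of Gaussian measures\<close>

lemma std_normal_cos_integral:
  "(\<integral>x. cos (\<sigma> * x + b) \<partial>std_normal_distribution) = exp (- (\<sigma>\<^sup>2) / 2) * cos b"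
proof -
  interpret real_distribution std_normal_distribution by (rule real_dist_normal_dist)
  have int: "integrable std_normal_distribution (\<lambda>x. cis b * iexp (\<sigma> * x))"
    by (rule integrable_const_bound[of _ 1]) (auto simp: norm_mult)
  have "(\<integral>x. cis b * iexp (\<sigma> * x) \<partial>std_normal_distribution) = cis b * exp (- (\<sigma>\<^sup>2) / 2)"
    using fun_cong[OF char_std_normal_distribution, of \<sigma>] by (simp add: char_def)
  then have "Re (\<integral>x. cis b * iexp (\<sigma> * x) \<partial>std_normal_distribution) = exp (- (\<sigma>\<^sup>2) / 2) * cos b"
    by simp
  moreover have "Re (cis b * iexp (\<sigma> * x)) = cos (\<sigma> * x + b)" for x
    unfolding cis_conv_exp[symmetric] by (simp add: cos_add)
  ultimately show ?thesis
    using integral_Re[OF int] by simp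
qed

lemma normal_density_eq_distr_std_normal:
  assumes "\<sigma> > 0"
  shows "density lborel (normal_density 0 \<sigma>) = distr std_normal_distribution borel (\<lambda>x. \<sigma> * x)"
proof -
  interpret real_distribution std_normal_distribution by (rule real_dist_normal_dist)
  have "distributed std_normal_distribution lborel (\<lambda>x. x) std_normal_density"
    by (auto simp: distributed_def distr_id2)
  from normal_density_affine[OF this, of \<sigma> 0] assms
  have "distributed std_normal_distribution lborel (\<lambda>x. \<sigma> * x) (normal_density 0 \<sigma>)"
    by simp
  then have "density lborel (normal_density 0 \<sigma>) = distr std_normal_distribution lborel (\<lambda>x. \<sigma> * x)"
    by (simp add: distributed_def)
  also have "\<dots> = distr std_normal_distribution borel (\<lambda>x. \<sigma> * x)"
    by (rule distr_cong) auto
  finally show ?thesis .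
qed

lemma blinfun_borel_measurable:
  fixes l :: "'a::real_normed_vector \<Rightarrow>\<^sub>L real"
  shows "blinfun_apply l \<in> borel_measurable borel"
  by (intro borel_measurable_continuous_onI linear_continuous_on blinfun.bounded_linear_right)

text \<open>The law of \<open>l\<close> is that of \<open>\<sigma>\<close> times a standard normal
  variable, including \<open>\<sigma> = 0\<close>. Writing \<open>\<sigma>\<^sup>2\<close> as the
  integral of the square of \<open>l\<close> makes the exponent an explicit quadratic form in
  \<open>l\<close>, which is the form that rotation invariance exploits.\<close>

lemma centered_gaussian_cos_integral:
  fixes l :: "'a::banach \<Rightarrow>\<^sub>L real"
  assumes \<mu>: "centered_gaussian_measure \<mu>"
  shows "integrable \<mu> (\<lambda>x. (l x)\<^sup>2)"
    and "(\<integral>x. cos (l x + b) \<partial>\<mu>) = exp (- (\<integral>x. (l x)\<^sup>2 \<partial>\<mu>) / 2) * cos b"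
proof -
  have [measurable_cong]: "sets \<mu> = sets borel" using \<mu> by (simp add: centered_gaussian_measure_def)
  have l[measurable]: "blinfun_apply l \<in> borel_measurable \<mu>"
    using blinfun_borel_measurable[of l] by measurable
  obtain \<sigma> where \<sigma>: "\<sigma> \<ge> 0" "distr \<mu> borel l =
      (if \<sigma> = 0 then return borel 0 else density lborel (normal_density 0 \<sigma>))"
    using \<mu> unfolding centered_gaussian_measure_def by blast
  have distr: "distr \<mu> borel l = distr std_normal_distribution borel (\<lambda>x. \<sigma> * x)"
  proof (cases "\<sigma> = 0")
    case True
    interpret real_distribution std_normal_distribution by (rule real_dist_normal_dist)
    have "distr std_normal_distribution borel (\<lambda>x. 0 :: real) = return borel 0"
      by (rule distr_const) simp
    then show ?thesis using \<sigma> True by simp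
  next
    case False
    then show ?thesis using \<sigma> normal_density_eq_distr_std_normal[of \<sigma>] by simp
  qed
  have "integrable (distr \<mu> borel l) (\<lambda>x. x\<^sup>2)"
    unfolding distr using integrable_std_normal_distribution_moment[of 2]
    by (subst integrable_distr_eq) (auto simp: power_mult_distrib)
  then show "integrable \<mu> (\<lambda>x. (l x)\<^sup>2)"
    by (subst (asm) integrable_distr_eq) auto
  have "(\<integral>x. (l x)\<^sup>2 \<partial>\<mu>) = (\<integral>x. x\<^sup>2 \<partial>distr \<mu> borel l)"
    by (subst integral_distr) auto
  also have "\<dots> = \<sigma>\<^sup>2 * (\<integral>x. x\<^sup>2 \<partial>std_normal_distribution)"
    unfolding distr by (subst integral_distr) (auto simp: power_mult_distrib)
  also have "\<dots> = \<sigma>\<^sup>2"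
    using std_normal_distribution_even_moments(1)[of 1] by simp
  finally have var: "(\<integral>x. (l x)\<^sup>2 \<partial>\<mu>) = \<sigma>\<^sup>2" .
  have "(\<integral>x. cos (l x + b) \<partial>\<mu>) = (\<integral>x. cos (x + b) \<partial>distr \<mu> borel l)"
    by (subst integral_distr) auto
  also have "\<dots> = (\<integral>x. cos (\<sigma> * x + b) \<partial>std_normal_distribution)"
    unfolding distr by (subst integral_distr) auto
  finally show "(\<integral>x. cos (l x + b) \<partial>\<mu>) = exp (- (\<integral>x. (l x)\<^sup>2 \<partial>\<mu>) / 2) * cos b"
    by (simp add: std_normal_cos_integral var)
qed

text \<open>Variance 0 would make the non-empty open set where \<open>l\<close> differs from 0 a
  null set. So the variance is positive, and a normal law with positive variance has no atom at
  0.\<close>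

lemma nondegenerate_gaussian_kernel_null:
  fixes l :: "'a::banach \<Rightarrow>\<^sub>L real"
  assumes \<mu>: "centered_gaussian_measure \<mu>" "nondegenerate_measure \<mu>" and "l \<noteq> 0"
  shows "emeasure \<mu> {x. l x = 0} = 0"
proof -
  have sets[measurable_cong]: "sets \<mu> = sets borel" using \<mu> by (simp add: centered_gaussian_measure_def)
  then have space: "space \<mu> = UNIV" using sets_eq_imp_space_eq by fastforce
  have l[measurable]: "blinfun_apply l \<in> borel_measurable \<mu>"
    using blinfun_borel_measurable[of l] by measurable
  have vim: "emeasure (distr \<mu> borel l) A = emeasure \<mu> {x. l x \<in> A}" if "A \<in> sets borel" for A
    using that by (simp add: emeasure_distr space vimage_def)
  obtain \<sigma> where \<sigma>: "\<sigma> \<ge> 0" "distr \<mu> borel l =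
      (if \<sigma> = 0 then return borel 0 else density lborel (normal_density 0 \<sigma>))"
    using \<mu> unfolding centered_gaussian_measure_def by blast
  have "\<sigma> \<noteq> 0"
  proof
    assume "\<sigma> = 0"
    then have "emeasure \<mu> {x. l x \<in> - {0}} = 0"
      using vim[of "- {0}"] \<sigma> by simp
    moreover have "open {x. l x \<in> - {0}}"
      using open_vimage[of "- {0}" "blinfun_apply l"]
      by (simp add: vimage_def open_Compl linear_continuous_on blinfun.bounded_linear_right)
    moreover have "{x. l x \<in> - {0}} \<noteq> {}"
      using \<open>l \<noteq> 0\<close> blinfun_eqI[of l 0] by auto
    ultimately show False
      using \<mu>(2) unfolding nondegenerate_measure_def by fastforce
  qed
  moreover have "{0} \<in> null_sets (density lborel (normal_density 0 \<sigma>))"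
  proof -
    have "AE x in lborel. x \<in> {0} \<longrightarrow> ennreal (normal_density 0 \<sigma> x) = 0"
      using AE_lborel_singleton[of "0 :: real"] by eventually_elim simp
    moreover have "(\<lambda>x. ennreal (normal_density 0 \<sigma> x)) \<in> borel_measurable lborel"
      and "{0 :: real} \<in> sets lborel"
      by simp_all
    ultimately show ?thesis using null_sets_density_iff by blast
  qed
  ultimately show ?thesis
    using vim[of "{0}"] \<sigma> by (simp add: null_setsD1)
qed

section \<open>Rotations of a pair of independent Gaussian elements\<close>

definition rotation :: "real \<Rightarrow> 'a::real_vector \<times> 'a \<Rightarrow> 'a \<times> 'a" where
  "rotation \<theta> z = (cos \<theta> *\<^sub>R fst z + sin \<theta> *\<^sub>R snd z, - sin \<theta> *\<^sub>R fst z + cos \<theta> *\<^sub>R snd z)"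

text \<open>Applied to either component, a functional gives a sum of products of
  \<open>cos \<theta>\<close> or \<open>sin \<theta>\<close> with functionals of
  \<open>fst z\<close> and \<open>snd z\<close>. Joint measurability with the angle is what Fubini
  requires later.\<close>

lemma measurable_rotation:
  fixes D :: "'a::real_normed_vector set"
  assumes D: "countable D" "closure D = UNIV"
  shows "(\<lambda>(\<theta>, z). rotation \<theta> z) \<in> borel \<Otimes>\<^sub>M (borel \<Otimes>\<^sub>M borel) \<rightarrow>\<^sub>M borel \<Otimes>\<^sub>M (borel :: 'a measure)"
  unfolding rotation_def case_prod_beta
  by (intro measurable_Pair measurable_if_functionals_measurable[OF D])
    (simp add: blinfun.bilinear_simps,
     intro borel_measurable_add borel_measurable_diff borel_measurable_times
       measurable_compose[OF _ blinfun_borel_measurable] measurable_compose[OF measurable_fst]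
       borel_measurable_continuous_onI continuous_intros;
     measurable)+

text \<open>By independence, the cosine integral of the functional with components \<open>l\<close>
  and \<open>m\<close> depends on them only through the integral of the sum of their squares, and a
  rotation leaves that sum unchanged.\<close>

lemma distr_rotation_gaussian:
  fixes \<mu> :: "'a::banach measure" and D :: "'a set"
  assumes \<mu>: "centered_gaussian_measure \<mu>" and D: "countable D" "closure D = UNIV"
  shows "distr (\<mu> \<Otimes>\<^sub>M \<mu>) (\<mu> \<Otimes>\<^sub>M \<mu>) (rotation \<theta>) = \<mu> \<Otimes>\<^sub>M \<mu>"
proof -
  interpret prob_space \<mu> using \<mu> by (simp add: centered_gaussian_measure_def)
  interpret pair_prob_space \<mu> \<mu> ..
  have sets[measurable_cong]: "sets \<mu> = sets borel" using \<mu> by (simp add: centered_gaussian_measure_def)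
  have space: "space \<mu> = UNIV" using sets sets_eq_imp_space_eq by fastforce
  have sets_pair: "sets (\<mu> \<Otimes>\<^sub>M \<mu>) = sets (borel \<Otimes>\<^sub>M borel)"
    by (intro sets_pair_measure_cong sets)
  have rot: "rotation \<theta> \<in> \<mu> \<Otimes>\<^sub>M \<mu> \<rightarrow>\<^sub>M \<mu> \<Otimes>\<^sub>M \<mu>"
    using measurable_compose[OF measurable_Pair1' measurable_rotation[OF D], of \<theta>]
    unfolding measurable_cong_sets[OF sets_pair sets_pair] by simp
  define F where "F = {(\<lambda>z. blinfun_apply l (fst z) + blinfun_apply m (snd z)) |
      (l :: 'a \<Rightarrow>\<^sub>L real) (m :: 'a \<Rightarrow>\<^sub>L real). True}"
  have F_meas: "(\<lambda>z. l (fst z) + m (snd z)) \<in> borel_measurable (\<mu> \<Otimes>\<^sub>M \<mu>)" for l m :: "'a \<Rightarrow>\<^sub>L real"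
    using blinfun_borel_measurable[of l] blinfun_borel_measurable[of m] by measurable
  have cos_int: "(\<integral>z. cos (l (fst z) + m (snd z) + b) \<partial>(\<mu> \<Otimes>\<^sub>M \<mu>)) =
      exp (- (\<integral>x. (l x)\<^sup>2 + (m x)\<^sup>2 \<partial>\<mu>) / 2) * cos b" for l m :: "'a \<Rightarrow>\<^sub>L real" and b
  proof -
    note [measurable] = F_meas[of l m]
    have "integrable (\<mu> \<Otimes>\<^sub>M \<mu>) (\<lambda>z. cos (l (fst z) + m (snd z) + b))"
      by (rule P.integrable_const_bound[of _ 1]) auto
    from integral_fst'[OF this]
    have "(\<integral>z. cos (l (fst z) + m (snd z) + b) \<partial>(\<mu> \<Otimes>\<^sub>M \<mu>)) =
        (\<integral>x. (\<integral>y. cos (m y + (l x + b)) \<partial>\<mu>) \<partial>\<mu>)"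
      by (simp add: ac_simps)
    also have "\<dots> = exp (- (\<integral>x. (m x)\<^sup>2 \<partial>\<mu>) / 2) * (exp (- (\<integral>x. (l x)\<^sup>2 \<partial>\<mu>) / 2) * cos b)"
      unfolding centered_gaussian_cos_integral(2)[OF \<mu>] by (simp add: centered_gaussian_cos_integral(2)[OF \<mu>])
    also have "\<dots> = exp (- (\<integral>x. (l x)\<^sup>2 + (m x)\<^sup>2 \<partial>\<mu>) / 2) * cos b"
      by (simp add: centered_gaussian_cos_integral(1)[OF \<mu>] diff_divide_distrib add_divide_distrib
          flip: exp_add mult.assoc)
    finally show ?thesis .
  qed
  have "\<mu> \<Otimes>\<^sub>M \<mu> = distr (\<mu> \<Otimes>\<^sub>M \<mu>) (\<mu> \<Otimes>\<^sub>M \<mu>) (rotation \<theta>)"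
  proof (rule measure_eqI_cos_integrals[where F = F])
    show "finite_measure (distr (\<mu> \<Otimes>\<^sub>M \<mu>) (\<mu> \<Otimes>\<^sub>M \<mu>) (rotation \<theta>))"
      using rot by (rule P.finite_measure_distr)
    show "F \<noteq> {}" by (auto simp: F_def)
    show "f \<in> borel_measurable (\<mu> \<Otimes>\<^sub>M \<mu>)" if "f \<in> F" for f
      using that F_meas by (auto simp: F_def)
    show "(\<lambda>x. s * f x + t * g x) \<in> F" if fg: "f \<in> F" "g \<in> F" for f g s t
    proof -
      obtain l m l' m' :: "'a \<Rightarrow>\<^sub>L real"
        where "f = (\<lambda>z. blinfun_apply l (fst z) + blinfun_apply m (snd z))"
          "g = (\<lambda>z. blinfun_apply l' (fst z) + blinfun_apply m' (snd z))"
        using fg by (auto simp: F_def)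
      then have "(\<lambda>x. s * f x + t * g x) =
          (\<lambda>z. (s *\<^sub>R l + t *\<^sub>R l') (fst z) + (s *\<^sub>R m + t *\<^sub>R m') (snd z))"
        by (simp add: fun_eq_iff blinfun.bilinear_simps algebra_simps)
      then show ?thesis by (auto simp: F_def)
    qed
    let ?G = "{f -` A \<inter> space (\<mu> \<Otimes>\<^sub>M \<mu>) | f A. f \<in> F \<and> A \<in> sets borel}"
    \<comment> \<open>Under the sigma-algebra generated by \<open>F\<close> both projections are
      measurable, tested by functionals; hence the identity into the product is measurable, which is
      the required inclusion.\<close>
    define N where "N = sigma (space (\<mu> \<Otimes>\<^sub>M \<mu>)) ?G"
    have N_space: "space N = space (\<mu> \<Otimes>\<^sub>M \<mu>)"
      unfolding N_def by (rule space_measure_of) auto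
    have N_sets: "sets N = sigma_sets (space (\<mu> \<Otimes>\<^sub>M \<mu>)) ?G"
      unfolding N_def by (rule sets_measure_of) auto
    have F_N: "f \<in> borel_measurable N" if "f \<in> F" for f
      using that by (intro measurableI) (auto simp: N_space N_sets)
    have "(\<lambda>z. l (fst z)) \<in> F" "(\<lambda>z. l (snd z)) \<in> F" for l :: "'a \<Rightarrow>\<^sub>L real"
    proof -
      have "(\<lambda>z. l (fst z)) = (\<lambda>z. l (fst z) + (0 :: 'a \<Rightarrow>\<^sub>L real) (snd z))"
        and "(\<lambda>z. l (snd z)) = (\<lambda>z. (0 :: 'a \<Rightarrow>\<^sub>L real) (fst z) + l (snd z))"
        by auto
      then show "(\<lambda>z. l (fst z)) \<in> F" "(\<lambda>z. l (snd z)) \<in> F"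
        unfolding F_def by blast+
    qed
    then have "fst \<in> N \<rightarrow>\<^sub>M borel" "snd \<in> N \<rightarrow>\<^sub>M borel"
      by (auto intro!: measurable_if_functionals_measurable[OF D] F_N)
    then have "(\<lambda>z. (fst z, snd z)) \<in> N \<rightarrow>\<^sub>M borel \<Otimes>\<^sub>M borel"
      by (rule measurable_Pair)
    then have id: "(\<lambda>z. z) \<in> N \<rightarrow>\<^sub>M borel \<Otimes>\<^sub>M borel"
      by (simp only: prod.collapse)
    show "sets (\<mu> \<Otimes>\<^sub>M \<mu>) \<subseteq> sigma_sets (space (\<mu> \<Otimes>\<^sub>M \<mu>)) ?G"
    proof
      fix T assume T: "T \<in> sets (\<mu> \<Otimes>\<^sub>M \<mu>)"
      then have "(\<lambda>z. z) -` T \<inter> space N \<in> sets N"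
        using id by (intro measurable_sets) (auto simp: sets_pair)
      moreover have "(\<lambda>z. z) -` T \<inter> space N = T"
        using sets.sets_into_space[OF T] unfolding N_space by auto
      ultimately show "T \<in> sigma_sets (space (\<mu> \<Otimes>\<^sub>M \<mu>)) ?G" by (simp only: N_sets)
    qed
    show "(\<integral>x. cos (f x + b) \<partial>(\<mu> \<Otimes>\<^sub>M \<mu>)) =
        (\<integral>x. cos (f x + b) \<partial>distr (\<mu> \<Otimes>\<^sub>M \<mu>) (\<mu> \<Otimes>\<^sub>M \<mu>) (rotation \<theta>))" if f_F: "f \<in> F" for f b
    proof -
      obtain l m :: "'a \<Rightarrow>\<^sub>L real"
        where f: "f = (\<lambda>z. blinfun_apply l (fst z) + blinfun_apply m (snd z))"
        using f_F by (auto simp: F_def)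
      note [measurable] = F_meas[of l m]
      \<comment> \<open>The adjoint rotation acting on the pair of functionals.\<close>
      define l' m' where "l' = cos \<theta> *\<^sub>R l - sin \<theta> *\<^sub>R m" and "m' = sin \<theta> *\<^sub>R l + cos \<theta> *\<^sub>R m"
      have rot_eq: "f (rotation \<theta> z) = l' (fst z) + m' (snd z)" for z
        by (simp add: f rotation_def l'_def m'_def blinfun.bilinear_simps algebra_simps)
      have "(l' x)\<^sup>2 + (m' x)\<^sup>2 = ((cos \<theta>)\<^sup>2 + (sin \<theta>)\<^sup>2) * ((l x)\<^sup>2 + (m x)\<^sup>2)" for x
        unfolding l'_def m'_def blinfun.bilinear_simps real_scaleR_def by algebra
      then have sq: "(l' x)\<^sup>2 + (m' x)\<^sup>2 = (l x)\<^sup>2 + (m x)\<^sup>2" for x by simp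
      have "(\<integral>x. cos (f x + b) \<partial>distr (\<mu> \<Otimes>\<^sub>M \<mu>) (\<mu> \<Otimes>\<^sub>M \<mu>) (rotation \<theta>)) =
          (\<integral>z. cos (f (rotation \<theta> z) + b) \<partial>(\<mu> \<Otimes>\<^sub>M \<mu>))"
        by (rule integral_distr[OF rot]) (simp add: f)
      then show ?thesis by (simp add: rot_eq cos_int sq) (simp add: f cos_int)
    qed
  qed (unfold_locales, simp)
  then show ?thesis by simp
qed

subsection \<open>Absolute continuity\<close>

text \<open>A nonzero derivative bounds the distance to nearby points by a multiple of the change of
  \<open>u\<close>. So \<open>S\<close> is covered by countably many pieces on which
  \<open>u\<close> has a Lipschitz inverse, and each is a Lipschitz image of a subset of
  \<open>N\<close>.\<close>

lemma negligible_vimage_nonzero_derivative: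
  fixes u u' :: "real \<Rightarrow> real"
  assumes N: "negligible N" and S: "S \<subseteq> u -` N"
    and der: "\<And>t. t \<in> S \<Longrightarrow> (u has_real_derivative u' t) (at t) \<and> u' t \<noteq> 0"
  shows "negligible S"
proof -
  define E where "E n = {t \<in> S. \<forall>s. \<bar>s - t\<bar> < 1 / Suc n \<longrightarrow> \<bar>s - t\<bar> \<le> Suc n * \<bar>u s - u t\<bar>}" for n :: nat
  \<comment> \<open>Cutting into cells of length \<open>1 / Suc n\<close> brings any two points of a
    piece close enough for the local bound of \<open>E n\<close> to hold between them.\<close>
  define P where "P n k = {t \<in> E n. \<lfloor>t * Suc n\<rfloor> = k}" for n :: nat and k :: int
  have "negligible (P n k)" for n k
  proof -
    have bound: "\<bar>s - t\<bar> \<le> Suc n * \<bar>u s - u t\<bar>" if "s \<in> P n k" "t \<in> P n k" for s t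
    proof -
      have "\<bar>s * Suc n - t * Suc n\<bar> < 1" using that unfolding P_def by simp linarith
      then have "\<bar>s - t\<bar> * Suc n < 1" by (simp add: abs_mult flip: left_diff_distrib)
      then have "\<bar>s - t\<bar> < 1 / Suc n" by (simp add: field_simps)
      then show ?thesis using that by (auto simp: P_def E_def)
    qed
    then have inj: "inj_on u (P n k)" by (fastforce intro: inj_onI)
    have "negligible (the_inv_into (P n k) u ` (u ` P n k))"
    proof (rule negligible_locally_Lipschitz_image)
      show "negligible (u ` P n k)"
        using S by (intro negligible_subset[OF N]) (auto simp: P_def E_def)
      show "\<exists>T B. open T \<and> x \<in> T \<and> (\<forall>y\<in>u ` P n k \<inter> T.
          norm (the_inv_into (P n k) u y - the_inv_into (P n k) u x) \<le> B * norm (y - x))"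
        if "x \<in> u ` P n k" for x
        using that bound inj
        by (intro exI[of _ UNIV] exI[of _ "real (Suc n)"]) (auto simp: the_inv_into_f_f)
    qed simp
    then show ?thesis using inj by simp
  qed
  then have "negligible (\<Union>n. \<Union>k. P n k)"
    by (intro negligible_countable_Union) auto
  moreover have "S \<subseteq> (\<Union>n. \<Union>k. P n k)"
  proof
    fix t assume t: "t \<in> S"
    have "((\<lambda>s. \<bar>(u s - u t) / (s - t)\<bar>) \<longlongrightarrow> \<bar>u' t\<bar>) (at t)"
      using der[OF t] unfolding has_field_derivative_iff by (intro tendsto_rabs) simp
    then have "\<forall>\<^sub>F s in at t. \<bar>(u s - u t) / (s - t)\<bar> > \<bar>u' t\<bar> / 2"
      using der[OF t] by (intro order_tendstoD) auto
    then obtain d where d: "d > 0"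
      "\<And>s. s \<noteq> t \<Longrightarrow> dist s t < d \<Longrightarrow> \<bar>u' t\<bar> / 2 < \<bar>(u s - u t) / (s - t)\<bar>"
      unfolding eventually_at by auto
    \<comment> \<open>One \<open>n\<close> serves twice: \<open>1 / Suc n < d\<close> is the radius,
      and \<open>1 / Suc n < \<bar>u' t\<bar> / 2\<close> provides the constant.\<close>
    have pos: "min d (\<bar>u' t\<bar> / 2) > 0" using d der[OF t] by simp
    obtain n where n: "inverse (real (Suc n)) < min d (\<bar>u' t\<bar> / 2)"
      using reals_Archimedean[OF pos] by blast
    have "\<bar>s - t\<bar> \<le> Suc n * \<bar>u s - u t\<bar>" if "\<bar>s - t\<bar> < 1 / Suc n" for s
    proof (cases "s = t")
      case False
      have "inverse (real (Suc n)) < \<bar>u' t\<bar> / 2" using n by simp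
      also have "\<dots> < \<bar>u s - u t\<bar> / \<bar>s - t\<bar>"
        unfolding abs_divide[symmetric] using that n
        by (intro d(2)[OF False]) (simp add: dist_real_def inverse_eq_divide)
      finally have "inverse (real (Suc n)) < \<bar>u s - u t\<bar> / \<bar>s - t\<bar>" .
      then show ?thesis using False by (simp add: field_simps)
    qed simp
    then have "t \<in> E n" using t by (simp add: E_def)
    then show "t \<in> (\<Union>n. \<Union>k. P n k)" by (auto simp: P_def)
  qed
  ultimately show ?thesis by (rule negligible_subset)
qed

text \<open>Presents the directional derivative as a sequential limit of expressions in
  \<open>V\<close>, so that the set where it vanishes inherits measurability from
  \<open>V\<close>.\<close>

lemma has_derivative_imp_difference_quotients:
  fixes V :: "'a::real_normed_vector \<Rightarrow> real"
  assumes "(V has_derivative V') (at x)"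
  shows "(\<lambda>n. (V (x + inverse (real (Suc n)) *\<^sub>R y) - V x) * real (Suc n)) \<longlonglongrightarrow> V' y"
proof -
  interpret bounded_linear V' using assms by (rule has_derivative_bounded_linear)
  have lin: "(\<lambda>t. V' (t *\<^sub>R w)) = (*) (V' w)" for w
    by (simp add: fun_eq_iff scaleR)
  have "((\<lambda>t. x + t *\<^sub>R y) has_derivative (\<lambda>t. t *\<^sub>R y)) (at 0)"
    by (auto intro!: derivative_eq_intros)
  then have "((\<lambda>t. V (x + t *\<^sub>R y)) has_derivative (\<lambda>t. V' (t *\<^sub>R y))) (at 0)"
    by (rule has_derivative_compose) (use assms in simp)
  then have "((\<lambda>t. V (x + t *\<^sub>R y)) has_real_derivative V' y) (at 0)"
    by (simp add: has_field_derivative_def lin)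
  then have "((\<lambda>t. (V (x + t *\<^sub>R y) - V x) / t) \<longlongrightarrow> V' y) (at 0)"
    by (simp add: DERIV_def)
  moreover have "filterlim (\<lambda>n. inverse (real (Suc n))) (at 0) sequentially"
    using LIMSEQ_inverse_real_of_nat by (auto simp: filterlim_at)
  ultimately have "(\<lambda>n. (V (x + inverse (real (Suc n)) *\<^sub>R y) - V x) / inverse (real (Suc n))) \<longlonglongrightarrow> V' y"
    by (rule filterlim_compose)
  then show ?thesis by (simp add: divide_inverse)
qed

lemma has_real_derivative_rotation:
  fixes V :: "'a::real_normed_vector \<Rightarrow> real"
  assumes "(V has_derivative V') (at (fst (rotation \<theta> z)))"
  shows "((\<lambda>\<theta>. V (fst (rotation \<theta> z))) has_real_derivative V' (snd (rotation \<theta> z))) (at \<theta>)"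
proof -
  interpret bounded_linear V' using assms by (rule has_derivative_bounded_linear)
  have lin: "(\<lambda>t. V' (t *\<^sub>R w)) = (*) (V' w)" for w
    by (simp add: fun_eq_iff scaleR)
  have "((\<lambda>\<theta>. fst (rotation \<theta> z)) has_derivative (\<lambda>t. t *\<^sub>R snd (rotation \<theta> z))) (at \<theta>)"
    unfolding rotation_def by (auto intro!: derivative_eq_intros simp: algebra_simps)
  then have "((\<lambda>\<theta>. V (fst (rotation \<theta> z))) has_derivative (\<lambda>t. V' (t *\<^sub>R snd (rotation \<theta> z)))) (at \<theta>)"
    by (rule has_derivative_compose) (rule assms)
  then show ?thesis
    by (simp add: has_field_derivative_def lin)
qed

theorem gaussian_vimage_null_set:
  fixes V :: "'a::banach \<Rightarrow> real" and dV :: "'a \<Rightarrow> 'a \<Rightarrow>\<^sub>L real"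
  assumes \<mu>: "centered_gaussian_measure \<mu>" "nondegenerate_measure \<mu>"
    and V: "V \<in> borel_measurable borel"
    and U: "open U" "\<And>x. x \<in> U \<Longrightarrow> (V has_derivative dV x) (at x) \<and> dV x \<noteq> 0"
    and N: "N \<in> null_sets lborel"
  shows "emeasure \<mu> (U \<inter> V -` N) = 0"
proof -
  interpret \<mu>: prob_space \<mu> using \<mu> by (simp add: centered_gaussian_measure_def)
  interpret pair_prob_space \<mu> \<mu> ..
  interpret L: pair_sigma_finite lborel "\<mu> \<Otimes>\<^sub>M \<mu>" ..
  have sets[measurable_cong]: "sets \<mu> = sets borel" using \<mu> by (simp add: centered_gaussian_measure_def)
  have space: "space \<mu> = UNIV" using sets sets_eq_imp_space_eq by fastforce
  obtain D :: "'a set" where D: "countable D" "closure D = UNIV"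
    using separable_if_nondegenerate[OF \<mu>.finite_measure_axioms sets \<mu>(2)] .
  have rot[measurable]: "(\<lambda>(\<theta>, z). rotation \<theta> z) \<in> lborel \<Otimes>\<^sub>M (\<mu> \<Otimes>\<^sub>M \<mu>) \<rightarrow>\<^sub>M \<mu> \<Otimes>\<^sub>M \<mu>"
    using measurable_rotation[OF D] by measurable
  have rot1[measurable]: "rotation \<theta> \<in> \<mu> \<Otimes>\<^sub>M \<mu> \<rightarrow>\<^sub>M \<mu> \<Otimes>\<^sub>M \<mu>" for \<theta>
    using measurable_compose[OF measurable_Pair1' rot, of \<theta>] by simp
  define G where "G = U \<inter> V -` N"
  have [measurable]: "N \<in> sets borel" using N by auto
  have [measurable]: "U \<in> sets borel" using U(1) by simp
  have G: "G \<in> sets \<mu>"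
    unfolding G_def sets using measurable_sets[OF V, of N] by simp
  define Q where "Q n z = (V (fst z + inverse (real (Suc n)) *\<^sub>R snd z) - V (fst z)) * real (Suc n)" for n z
  have Q_lim: "(\<lambda>n. Q n z) \<longlonglongrightarrow> dV (fst z) (snd z)" if "fst z \<in> U" for z
    unfolding Q_def using U(2)[OF that] has_derivative_imp_difference_quotients by blast
  have Q_meas: "Q n \<in> borel_measurable (\<mu> \<Otimes>\<^sub>M \<mu>)" for n
  proof -
    have "(\<lambda>z :: 'a \<times> 'a. fst z + inverse (real (Suc n)) *\<^sub>R snd z) \<in> borel_measurable (\<mu> \<Otimes>\<^sub>M \<mu>)"
    proof (rule measurable_if_functionals_measurable[OF D])
      fix l :: "'a \<Rightarrow>\<^sub>L real"
      note [measurable] = blinfun_borel_measurable[of l]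
      show "(\<lambda>z :: 'a \<times> 'a. l (fst z + inverse (real (Suc n)) *\<^sub>R snd z)) \<in> borel_measurable (\<mu> \<Otimes>\<^sub>M \<mu>)"
        unfolding blinfun.bilinear_simps by measurable
    qed
    from measurable_compose[OF this V] show ?thesis
      unfolding Q_def[abs_def] using V by measurable
  qed
  \<comment> \<open>Over \<open>U\<close> this is the vanishing set of the derivative at
    \<open>fst z\<close> in direction \<open>snd z\<close>, written with limits to be visibly
    measurable. Its sections are kernels of nonzero functionals, hence null.\<close>
  define Z where "Z = {z \<in> U \<times> UNIV. (\<lambda>n. Q n z) \<longlonglongrightarrow> 0}"
  have Z[measurable]: "Z \<in> sets (\<mu> \<Otimes>\<^sub>M \<mu>)"
    unfolding Z_def using Q_meas by (intro measurable_P_restriction measurable_limit pair_measureI) (auto simp: sets U)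
  have Z_iff: "z \<in> Z \<longleftrightarrow> dV (fst z) (snd z) = 0" if "fst z \<in> U" for z
    using Q_lim[OF that] LIMSEQ_unique that by (auto simp: Z_def mem_Times_iff)
  have "emeasure \<mu> (Pair x -` Z) = 0" for x
  proof (cases "x \<in> U")
    case True
    then have "Pair x -` Z = {y. dV x y = 0}" using Z_iff by auto
    then show ?thesis using nondegenerate_gaussian_kernel_null[OF \<mu>] U(2)[OF True] by simp
  next
    case False
    then have "Pair x -` Z = {}" by (auto simp: Z_def)
    then show ?thesis by simp
  qed
  then have Z_null: "emeasure (\<mu> \<Otimes>\<^sub>M \<mu>) Z = 0"
    by (simp add: \<mu>.emeasure_pair_measure_alt[OF Z])
  \<comment> \<open>The bad event off \<open>Z\<close>; \<open>W\<close> collects all angles and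
    pairs for which the rotated pair falls into it.\<close>
  define H where "H = G \<times> UNIV - Z"
  have GU: "G \<times> UNIV \<in> sets (\<mu> \<Otimes>\<^sub>M \<mu>)"
    using G by (intro pair_measureI) (auto simp: sets)
  have H[measurable]: "H \<in> sets (\<mu> \<Otimes>\<^sub>M \<mu>)" unfolding H_def using GU Z by (rule sets.Diff)
  define W where "W = (\<lambda>(\<theta>, z). rotation \<theta> z) -` H \<inter> space (lborel \<Otimes>\<^sub>M (\<mu> \<Otimes>\<^sub>M \<mu>))"
  have W: "W \<in> sets (lborel \<Otimes>\<^sub>M (\<mu> \<Otimes>\<^sub>M \<mu>))" unfolding W_def by (rule measurable_sets[OF rot H])
  have W_iff: "(\<theta>, z) \<in> W \<longleftrightarrow> rotation \<theta> z \<in> H" for \<theta> z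
    by (simp add: W_def space_pair_measure space)
  have inv: "emeasure (\<mu> \<Otimes>\<^sub>M \<mu>) (Pair \<theta> -` W) = emeasure (\<mu> \<Otimes>\<^sub>M \<mu>) H" for \<theta>
  proof -
    have "Pair \<theta> -` W = rotation \<theta> -` H \<inter> space (\<mu> \<Otimes>\<^sub>M \<mu>)"
      by (auto simp: W_iff space_pair_measure space)
    then show ?thesis
      using emeasure_distr[OF rot1 H, of \<theta>] distr_rotation_gaussian[OF \<mu>(1) D] by simp
  qed
  have null: "emeasure lborel ((\<lambda>\<theta>. (\<theta>, z)) -` W) = 0" for z
  proof -
    define T where "T = (\<lambda>\<theta>. (\<theta>, z)) -` W"
    have T_sets: "T \<in> sets lborel" unfolding T_def by (rule sets_Pair2[OF W])
    have "negligible T"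
    proof (rule negligible_vimage_nonzero_derivative)
      show "negligible N" using N by (simp add: negligible_iff_null_sets null_sets_completionI)
      show "T \<subseteq> (\<lambda>\<theta>. V (fst (rotation \<theta> z))) -` N"
        by (auto simp: T_def W_iff H_def G_def mem_Times_iff)
      fix \<theta> assume "\<theta> \<in> T"
      then have "fst (rotation \<theta> z) \<in> U" and "rotation \<theta> z \<notin> Z"
        by (auto simp: T_def W_iff H_def G_def mem_Times_iff)
      then show "((\<lambda>\<theta>. V (fst (rotation \<theta> z))) has_real_derivative
            dV (fst (rotation \<theta> z)) (snd (rotation \<theta> z))) (at \<theta>) \<and>
          dV (fst (rotation \<theta> z)) (snd (rotation \<theta> z)) \<noteq> 0"
        using U(2) has_real_derivative_rotation Z_iff by blast
    qed
    \<comment> \<open>Negligibility refers to the completed measure; as \<open>T\<close> is Borel,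
      it has the same mass under \<open>lborel\<close>.\<close>
    then have "emeasure lebesgue T = 0"
      by (simp add: negligible_iff_null_sets null_setsD1)
    then show ?thesis using T_sets by (simp add: T_def)
  qed
  \<comment> \<open>The mass of \<open>W\<close> is computed in both orders. Every angle contributes
    the mass of \<open>H\<close> and the line has infinite length, while for fixed \<open>z\<close>
    the angles form a null set; infinity times the mass of \<open>H\<close> is thus 0.\<close>
  have "emeasure (\<mu> \<Otimes>\<^sub>M \<mu>) H * \<infinity> = (\<integral>\<^sup>+\<theta>. emeasure (\<mu> \<Otimes>\<^sub>M \<mu>) (Pair \<theta> -` W) \<partial>lborel)"
    by (simp add: inv)
  also have "\<dots> = emeasure (lborel \<Otimes>\<^sub>M (\<mu> \<Otimes>\<^sub>M \<mu>)) W"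
    by (rule P.emeasure_pair_measure_alt[OF W, symmetric])
  also have "\<dots> = 0"
    by (simp add: L.emeasure_pair_measure_alt2[OF W] null)
  finally have H_null: "emeasure (\<mu> \<Otimes>\<^sub>M \<mu>) H = 0" by (simp add: ennreal_mult_eq_top_iff)
  have "emeasure \<mu> G = emeasure (\<mu> \<Otimes>\<^sub>M \<mu>) (G \<times> space \<mu>)"
    using G by (simp add: \<mu>.emeasure_pair_measure_Times \<mu>.emeasure_space_1)
  also have "\<dots> \<le> emeasure (\<mu> \<Otimes>\<^sub>M \<mu>) (H \<union> Z)"
    by (intro emeasure_mono sets.Un H Z) (auto simp: H_def)
  also have "\<dots> \<le> emeasure (\<mu> \<Otimes>\<^sub>M \<mu>) H + emeasure (\<mu> \<Otimes>\<^sub>M \<mu>) Z"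
    by (rule emeasure_subadditive[OF H Z])
  finally show ?thesis by (simp add: H_null Z_null G_def)
qed

theorem theorem3p2:
  fixes M :: "'w measure" and X :: "'w \<Rightarrow> 'a::banach"
    and V :: "'a \<Rightarrow> real" and dV :: "'a \<Rightarrow> 'a \<Rightarrow>\<^sub>L real"
    and U\<^sub>0 :: "'a set" and f :: 'a
  assumes "prob_space M"
    and "X \<in> measurable M borel"
    and "centered_gaussian_measure (distr M borel X)"
    and "nondegenerate_measure (distr M borel X)"
    and "V \<in> borel_measurable borel"
    and "open U\<^sub>0"
    and "C1_on_with V U\<^sub>0 dV"
    and "f \<in> U\<^sub>0"
    and "dV f \<noteq> 0"
  shows "\<exists>\<O>. open \<O> \<and> f \<in> \<O> \<and> \<O> \<subseteq> U\<^sub>0 \<and>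
           absolutely_continuous lborel
             (law_on M (X -` \<O>) (\<lambda>\<omega>. V (X \<omega>) * indicator \<O> (X \<omega>)))"
proof -
  \<comment> \<open>This is the neighborhood sought: continuity of \<open>dV\<close> makes it open,
    and it contains \<open>f\<close>.\<close>
  define U where "U = U\<^sub>0 \<inter> dV -` (- {0})"
  note X[measurable] = assms(2) and V[measurable] = assms(5)
  have "open U"
    unfolding U_def using assms(6,7)
    by (intro continuous_open_preimage) (auto simp: C1_on_with_def)
  then have U[measurable]: "U \<in> sets borel" by simp
  define Y where "Y \<omega> = V (X \<omega>) * indicator U (X \<omega>)" for \<omega>
  have Y[measurable]: "Y \<in> borel_measurable M" unfolding Y_def by measurable
  have XO: "X -` U \<inter> space M \<in> sets M" by (rule measurable_sets[OF X U])
  have "absolutely_continuous lborel (law_on M (X -` U) Y)"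
    unfolding absolutely_continuous_def
  proof
    fix N :: "real set" assume N: "N \<in> null_sets lborel"
    then have [measurable]: "N \<in> sets borel" by auto
    have "emeasure (law_on M (X -` U) Y) N =
        emeasure (restrict_space M (X -` U \<inter> space M)) (Y -` N \<inter> space (restrict_space M (X -` U \<inter> space M)))"
      unfolding law_on_def by (rule emeasure_distr) (auto intro: measurable_restrict_space1)
    \<comment> \<open>On the event that \<open>X\<close> lies in \<open>U\<close> the indicator is
      1, so \<open>Y\<close> equals \<open>V (X \<omega>)\<close> there and the cut-off value 0
      never enters.\<close>
    also have "Y -` N \<inter> space (restrict_space M (X -` U \<inter> space M)) = X -` (U \<inter> V -` N) \<inter> space M"
      by (auto simp: space_restrict_space Y_def)
    also have "emeasure (restrict_space M (X -` U \<inter> space M)) \<dots> = emeasure M (X -` (U \<inter> V -` N) \<inter> space M)"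
      using XO by (intro emeasure_restrict_space) auto
    also have "\<dots> = emeasure (distr M borel X) (U \<inter> V -` N)"
      using measurable_sets[OF V, of N] by (intro emeasure_distr[OF X, symmetric]) auto
    also have "\<dots> = 0"
      using gaussian_vimage_null_set[OF assms(3,4) V \<open>open U\<close> _ N, of dV] assms(7)
      by (auto simp: U_def C1_on_with_def)
    finally show "N \<in> null_sets (law_on M (X -` U) Y)"
      by (auto simp: null_sets_def law_on_def)
  qed
  moreover have "f \<in> U" "U \<subseteq> U\<^sub>0" using assms(8,9) by (auto simp: U_def)
  ultimately show ?thesis using \<open>open U\<close> unfolding Y_def by blast
qed

end
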